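(* Let $p$ be a prime power such that $p-1$ is also a prime power, and set $r=2p-1$. Construct the hypergraph $\mathcal{G}_r$ as follows. Let $\mathcal{J}$ be the hypergraph obtained from the affine plane $\mathrm{AG}(2,p-1)$ by choosing one parallel class $B_1$, removing its lines from the edge set, and declaring those $p-1$ lines to be the vertex classes; so $\mathcal{J}$ is $(p-1)$-partite, $(p-1)$-uniform, and its edges form $p-1$ parallel classes (the remaining parallel classes of $\mathrm{AG}(2,p-1)$), each consisting of $p-1$ pairwise disjoint edges. Take $\mathcal{A}_p$ with vertex classes $V_1,\dots,V_{p+1}$ and edge classes $C_1,\dots,C_{p+1}$ (as in the context), and introduce $p-2$ further vertex classes $V_{p+2},\dots,V_{2p-1}$. For each $i=1,\dots,p+1$ take a copy $\mathcal{J}^i$ of $\mathcal{J}$ on new vertices, the copies being pairwise vertex-disjoint and disjoint from the vertex set of $\mathcal{A}_p$; the vertices of one vertex class of $\mathcal{J}^i$ are added to the class $V_i$, and the vertices of the remaining $p-2$ classes of $\mathcal{J}^i$ are added, one class to each, to $V_{p+2},\dots,V_{2p-1}$ (arbitrarily). For each $i$ fix an arbitrary bijection between the $p-1$ edges of $C_i$ and the $p-1$ parallel classes of $\mathcal{J}^i$, and for each $e\in C_i$ include in $\mathcal{G}_r$ the $p-1$ edges $e\cup f$, where $f$ ranges over the edges of the parallel class of $\mathcal{J}^i$ assigned to $e$. These are all the edges of $\mathcal{G}_r$. Then: (1) $\mathcal{G}_r$ is an $r$-partite $r$-uniform intersecting hypergraph (with respect to the enlarged classes $V_1,\dots,V_{2p-1}$);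 (2) $\tau(\mathcal{G}_r)\ge r-1$.
   Context: A hypergraph is $r$-partite if its vertex set has a partition into $r$ classes such that every edge contains at most one vertex of each class; it is $r$-uniform if every edge has exactly $r$ vertices; it is intersecting if every two edges share a vertex. $\tau(\mathcal{H})$ denotes the minimum size of a vertex cover (a set of vertices meeting every edge). For a prime power $q$, the affine plane $\mathrm{AG}(2,q)$ is obtained from the projective plane $\mathrm{PG}(2,q)$ of order $q$ by deleting one line and all its points; it has $q^2$ points, lines of size $q$, and $q+1$ parallel classes of $q$ pairwise disjoint lines, with lines from different parallel classes meeting in exactly one point. The hypergraph $\mathcal{A}_p$: fix a point $x$ of $\mathrm{AG}(2,p)$; the vertices of $\mathcal{A}_p$ are the points other than $x$, and its edges are the lines not containing $x$. If $L_1,\dots,L_{p+1}$ are the lines through $x$, then $V_i=L_i\setminus\{x\}$ (so $|V_i|=p-1$), and $C_i$ is the set of edges of $\mathcal{A}_p$ parallel to $L_i$; thus $C_i$ consists of $p-1$ pairwise disjoint $p$-element edges, each disjoint from $V_i$ and meeting each $V_j$, $j\ne i$, in exactly one vertex. *)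

theory Defs
  imports "HOL-Analysis.Analysis" "HOL-Number_Theory.Prime_Powers"
begin

subsection \<open>Hypergraphs\<close>

record 'v hypergraph =
  verts :: "'v set"
  edges :: "'v set set"

definition finite_hypergraph :: "'v hypergraph \<Rightarrow> bool" where
  "finite_hypergraph H \<longleftrightarrow> finite (verts H) \<and> (\<forall>e\<in>edges H. e \<subseteq> verts H)"

text \<open>The members of a partition in the sense of \<^const>\<open>partition_on\<close> are nonempty.
  ``At most one vertex'' is not phrased with \<^const>\<open>card\<close>, which is 0 on infinite sets.\<close>

definition partite_with :: "nat \<Rightarrow> 'v hypergraph \<Rightarrow> 'v set set \<Rightarrow> bool" where
  "partite_with r H P \<longleftrightarrow>
     partition_on (verts H) P \<and> finite P \<and> card P = r \<and>
     (\<forall>e\<in>edges H. \<forall>c\<in>P. \<forall>u\<in>e \<inter> c. \<forall>v\<in>e \<inter> c. u = v)"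

definition uniform :: "nat \<Rightarrow> 'v hypergraph \<Rightarrow> bool" where
  "uniform r H \<longleftrightarrow> (\<forall>e\<in>edges H. finite e \<and> card e = r)"

definition intersecting :: "'v hypergraph \<Rightarrow> bool" where
  "intersecting H \<longleftrightarrow> (\<forall>e\<in>edges H. \<forall>f\<in>edges H. e \<inter> f \<noteq> {})"

definition vertex_cover :: "'v hypergraph \<Rightarrow> 'v set \<Rightarrow> bool" where
  "vertex_cover H T \<longleftrightarrow> T \<subseteq> verts H \<and> (\<forall>e\<in>edges H. T \<inter> e \<noteq> {})"

text \<open>Meaningful when a finite cover exists, in particular for a finite hypergraph
  without empty edges.\<close>

definition cover_number :: "'v hypergraph \<Rightarrow> nat" where
  "cover_number H = (LEAST n. \<exists>T. vertex_cover H T \<and> finite T \<and> card T = n)"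


subsection \<open>Desarguesian projective and affine planes\<close>

text \<open>For a finite field \<open>'k\<close> with \<open>q\<close> elements these are the points and lines of
  \<open>PG(2,q)\<close>: the one-dimensional subspaces of the three-dimensional space over \<open>'k\<close>, and,
  for each two-dimensional subspace, the set of points contained in it.\<close>

definition PG_points :: "('k::field ^ 3) set set" where
  "PG_points = {P. vec.subspace P \<and> vec.dim P = 1}"

definition PG_lines :: "('k::field ^ 3) set set set" where
  "PG_lines = {{P \<in> PG_points. P \<subseteq> W} |W. vec.subspace W \<and> vec.dim W = 2}"

text \<open>The affine plane obtained by deleting the line \<open>m\<close> of the projective plane
  together with all its points.\<close>

definition AG_points :: "('k::field ^ 3) set set \<Rightarrow> ('k ^ 3) set set" where
  "AG_points m = PG_points - m"

definition AG_lines :: "('k::field ^ 3) set set \<Rightarrow> ('k ^ 3) set set set" where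
  "AG_lines m = {l - m |l. l \<in> PG_lines \<and> l \<noteq> m}"

definition parallel :: "'a set \<Rightarrow> 'a set \<Rightarrow> bool" where
  "parallel l l' \<longleftrightarrow> l = l' \<or> l \<inter> l' = {}"

definition AG_parallel_classes :: "('k::field ^ 3) set set \<Rightarrow> ('k ^ 3) set set set set" where
  "AG_parallel_classes m = {{l' \<in> AG_lines m. parallel l l'} |l. l \<in> AG_lines m}"


subsection \<open>The hypergraphs \<open>\<A>\<^sub>p\<close> and \<open>\<J>\<close>\<close>

definition A_hyp :: "('k::field ^ 3) set set \<Rightarrow> ('k ^ 3) set \<Rightarrow> ('k ^ 3) set hypergraph" where
  "A_hyp m x = \<lparr>verts = AG_points m - {x}, edges = {l \<in> AG_lines m. x \<notin> l}\<rparr>"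

definition A_edge_class ::
    "('k::field ^ 3) set set \<Rightarrow> ('k ^ 3) set \<Rightarrow> ('k ^ 3) set set \<Rightarrow> ('k ^ 3) set set set" where
  "A_edge_class m x l = {e \<in> edges (A_hyp m x). parallel e l}"

text \<open>Here \<open>B\<close> is a parallel class; its lines are the vertex classes of \<open>\<J>\<close>.\<close>

definition J_hyp :: "('k::field ^ 3) set set \<Rightarrow> ('k ^ 3) set set set \<Rightarrow> ('k ^ 3) set hypergraph" where
  "J_hyp m B = \<lparr>verts = AG_points m, edges = AG_lines m - B\<rparr>"

definition J_edge_classes ::
    "('k::field ^ 3) set set \<Rightarrow> ('k ^ 3) set set set \<Rightarrow> ('k ^ 3) set set set set" where
  "J_edge_classes m B = AG_parallel_classes m - {B}"


subsection \<open>The hypergraph \<open>\<G>\<^sub>r\<close>\<close>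

text \<open>Vertices of \<open>\<A>\<^sub>p\<close> are tagged by \<^const>\<open>Inl\<close>; the vertex \<open>y\<close> of the \<open>i\<close>-th copy of \<open>\<J>\<close>
  is \<open>Inr (i, y)\<close>, so the copies are disjoint from each other and from \<open>\<A>\<^sub>p\<close>.\<close>

definition copy :: "nat \<Rightarrow> 'w set \<Rightarrow> ('v + nat \<times> 'w) set" where
  "copy i S = (\<lambda>y. Inr (i, y)) ` S"

text \<open>Parameters: \<open>m\<close>, \<open>x\<close> determine \<open>\<A>\<^sub>p\<close>, and \<open>L 1, \<dots>, L (p + 1)\<close> are the lines through \<open>x\<close>;
  \<open>m'\<close>, \<open>B\<close> determine \<open>\<J>\<close>; \<open>\<phi> i\<close> assigns to each edge of the \<open>i\<close>-th edge class of \<open>\<A>\<^sub>p\<close>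
  a parallel class of \<open>\<J>\<close>.\<close>

definition G_hyp ::
    "nat \<Rightarrow> ('k::field ^ 3) set set \<Rightarrow> ('k ^ 3) set \<Rightarrow> (nat \<Rightarrow> ('k ^ 3) set set) \<Rightarrow>
     ('l::field ^ 3) set set \<Rightarrow> ('l ^ 3) set set set \<Rightarrow>
     (nat \<Rightarrow> ('k ^ 3) set set \<Rightarrow> ('l ^ 3) set set set) \<Rightarrow>
     (('k ^ 3) set + nat \<times> ('l ^ 3) set) hypergraph" where
  "G_hyp p m x L m' B \<phi> =
     \<lparr>verts = Inl ` verts (A_hyp m x) \<union> (\<Union>i\<in>{1..p+1}. copy i (verts (J_hyp m' B))),
      edges = {Inl ` e \<union> copy i f |i e f.
                 i \<in> {1..p+1} \<and> e \<in> A_edge_class m x (L i) \<and> f \<in> \<phi> i e}\<rparr>"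

text \<open>The enlarged class with index \<open>j\<close>, where \<open>\<sigma> i b\<close> is the index of the class to which the
  vertices of the vertex class \<open>b\<close> of the \<open>i\<close>-th copy of \<open>\<J>\<close> are added.\<close>

definition G_class ::
    "nat \<Rightarrow> ('k::field ^ 3) set \<Rightarrow> (nat \<Rightarrow> ('k ^ 3) set set) \<Rightarrow>
     ('l::field ^ 3) set set set \<Rightarrow> (nat \<Rightarrow> ('l ^ 3) set set \<Rightarrow> nat) \<Rightarrow>
     nat \<Rightarrow> (('k ^ 3) set + nat \<times> ('l ^ 3) set) set" where
  "G_class p x L B \<sigma> j =
     (if j \<le> p + 1 then Inl ` (L j - {x}) else {}) \<union>
     (\<Union>i\<in>{1..p+1}. \<Union>b\<in>{b \<in> B. \<sigma> i b = j}. copy i b)"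

end

theory Submission
  imports Defs
begin

text \<open>Only the bound on the cover number needs more than incidence geometry. A cover of the edges of
  \<open>\<A>\<^sub>p\<close> becomes, together with \<open>x\<close>, a blocking set of \<open>AG(2,p)\<close>, and in the Desarguesian plane such
  a set has at least \<open>2p - 1\<close> points by the theorem of Jamison and of Brouwer and Schrijver. A cover
  of \<open>\<G>\<^sub>r\<close> that misses an edge of \<open>C\<^sub>i\<close> in \<open>\<A>\<^sub>p\<close> has to meet a whole parallel class in the \<open>i\<close>-th copy
  of \<open>\<J>\<close>.\<close>

section \<open>Power sums over finite fields\<close>

text \<open>Two edges of the same \<open>C\<^sub>i\<close> are disjoint in
  \<open>\<A>\<^sub>p\<close>; the copies of \<open>\<J>\<close> exist to make them meet. Different
  edges of \<open>C\<^sub>i\<close> receive different parallel classes, and lines of different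
  classes cross. Dropping \<open>B\<close> leaves p - 1 parallel classes, exactly the size of
  \<open>C\<^sub>i\<close>, and every remaining line crosses each line of \<open>B\<close> once, so
  those lines can serve as vertex classes. An edge of \<open>C\<^sub>i\<close> misses
  \<open>L i\<close>, so one class of the copy can be stored there and only p - 2 new classes are
  needed: (p + 1) + (p - 2) = 2p - 1. Without \<open>x\<close> the blocking bound leaves 2(p - 1) =
  r - 1 vertices, which is also twice the cost p - 1 of meeting a parallel class. Field arithmetic
  enters only through the blocking bound; the rest of the argument uses incidence axioms, for which
  coordinates merely supply a model.\<close>

lemma of_nat_CARD_eq_0: "of_nat CARD('k) = (0 :: 'k::{field,finite})"
proof -
  have "(\<Sum>t\<in>(UNIV::'k set). t) = (\<Sum>t\<in>UNIV. t + 1)"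
    by (rule sum.reindex_bij_witness[of _ "\<lambda>t. t + 1" "\<lambda>t. t - 1"]) auto
  also have "\<dots> = (\<Sum>t\<in>UNIV. t) + of_nat CARD('k)"
    by (simp add: sum.distrib)
  finally show ?thesis by simp
qed

text \<open>Multiplication by a nonzero \<open>g\<close> permutes the field and multiplies the sum
  by \<open>g ^ a\<close>. Some \<open>g\<close> has \<open>g ^ a \<noteq> 1\<close>, because X^a -
  1 has at most \<open>a\<close> roots, fewer than there are nonzero elements.\<close>

lemma sum_power_UNIV_eq_0:
  assumes "a < CARD('k) - 1"
  shows "(\<Sum>t\<in>UNIV. t ^ a) = (0 :: 'k::{field,finite})"
proof (cases "a = 0")
  case True
  \<comment> \<open>Since \<open>0 ^ 0 = 1\<close>, the sum here is the field size, which is 0 in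
    the field.\<close>
  then show ?thesis by (simp add: of_nat_CARD_eq_0)
next
  case False
  define f :: "'k poly" where "f = monom 1 a - 1"
  have cf: "coeff f a = 1" using False by (simp add: f_def)
  then have "f \<noteq> 0" by auto
  have "degree f \<le> a" unfolding f_def
    by (intro degree_diff_le) (auto simp: degree_monom_le)
  have "card {t. poly f t = 0} \<le> a"
    using card_poly_roots_bound[OF \<open>f \<noteq> 0\<close>] \<open>degree f \<le> a\<close> by linarith
  also have "a < card (UNIV - {0::'k})"
    using assms by (simp add: card_Diff_singleton)
  finally have "\<not> UNIV - {0} \<subseteq> {t. poly f t = 0}"
    by (metis card_mono finite not_le)
  then obtain g where "g \<noteq> 0" "poly f g \<noteq> 0"
    by blast
  then have g: "g \<noteq> 0" "g ^ a \<noteq> 1"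
    by (auto simp: f_def poly_monom)
  have "(\<Sum>t\<in>UNIV. t ^ a) = (\<Sum>t\<in>UNIV. (g * t) ^ a)"
    using g by (intro sum.reindex_bij_witness[of _ "\<lambda>t. g * t" "\<lambda>t. t / g"]) auto
  also have "\<dots> = g ^ a * (\<Sum>t\<in>UNIV. t ^ a)"
    by (simp add: power_mult_distrib sum_distrib_left)
  finally show ?thesis using g by auto
qed

text \<open>By degree: in a monomial of total degree below 2(q - 1) one exponent is below q - 1, and
  the sum over that variable vanishes. The extra factor \<open>s ^ a * t ^ b\<close> is for the
  induction: expanding one affine factor raises \<open>a\<close> or \<open>b\<close> by at most 1
  while \<open>card S\<close> drops by 1, so the bound is preserved.\<close>

lemma sum_monomial_prod_affine_eq_0:
  fixes f g :: "'a \<Rightarrow> 'k::{field,finite}"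
  assumes "finite S" and "card S + a + b < 2 * (CARD('k) - 1)"
  shows "(\<Sum>s\<in>UNIV. \<Sum>t\<in>UNIV. s ^ a * t ^ b * (\<Prod>i\<in>S. 1 + s * f i + t * g i)) = 0"
  using assms
proof (induction S arbitrary: a b rule: finite_induct)
  case empty
  have "(\<Sum>s\<in>UNIV. s ^ a) * (\<Sum>t\<in>UNIV. t ^ b) = (0::'k)"
  proof (cases "a < CARD('k) - 1")
    case False
    with empty have "b < CARD('k) - 1" by simp
    then show ?thesis by (simp add: sum_power_UNIV_eq_0)
  qed (simp add: sum_power_UNIV_eq_0)
  then show ?case by (simp add: sum_product)
next
  case (insert j S)
  let ?M = "\<lambda>a b. \<Sum>s\<in>UNIV. \<Sum>t\<in>UNIV. s ^ a * t ^ b * (\<Prod>i\<in>S. 1 + s * f i + t * g i)"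
  have "(\<Sum>s\<in>UNIV. \<Sum>t\<in>UNIV. s ^ a * t ^ b * (\<Prod>i\<in>insert j S. 1 + s * f i + t * g i))
      = ?M a b + f j * ?M (Suc a) b + g j * ?M a (Suc b)"
    using insert.hyps by (simp add: sum_distrib_left sum.distrib[symmetric] algebra_simps)
  moreover have "?M a b = 0" "?M (Suc a) b = 0" "?M a (Suc b) = 0"
    using insert.prems insert.hyps by (auto simp del: power_Suc intro!: insert.IH)
  ultimately show ?case by simp
qed

section \<open>Dot and cross product over a field\<close>

definition dot3 :: "'k::field ^ 3 \<Rightarrow> 'k ^ 3 \<Rightarrow> 'k" (infixl "\<bullet>\<^sub>3" 70) where
  "u \<bullet>\<^sub>3 v = u $ 1 * v $ 1 + u $ 2 * v $ 2 + u $ 3 * v $ 3"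

definition crs3 :: "'k::field ^ 3 \<Rightarrow> 'k ^ 3 \<Rightarrow> 'k ^ 3" (infixr "\<times>\<^sub>3" 75) where
  "u \<times>\<^sub>3 v = vector [u $ 2 * v $ 3 - u $ 3 * v $ 2,
                  u $ 3 * v $ 1 - u $ 1 * v $ 3,
                  u $ 1 * v $ 2 - u $ 2 * v $ 1]"

lemma dot3_linear [simp]:
  "(u + v) \<bullet>\<^sub>3 w = u \<bullet>\<^sub>3 w + v \<bullet>\<^sub>3 w" "u \<bullet>\<^sub>3 (v + w) = u \<bullet>\<^sub>3 v + u \<bullet>\<^sub>3 w"
  "(c *s u) \<bullet>\<^sub>3 w = c * (u \<bullet>\<^sub>3 w)" "u \<bullet>\<^sub>3 (c *s w) = c * (u \<bullet>\<^sub>3 w)"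
  "u \<bullet>\<^sub>3 0 = 0" "0 \<bullet>\<^sub>3 u = 0"
  by (simp_all add: dot3_def algebra_simps)

lemma dot3_commute: "u \<bullet>\<^sub>3 v = v \<bullet>\<^sub>3 u"
  by (simp add: dot3_def mult.commute)

lemma dot3_crs3 [simp]: "u \<bullet>\<^sub>3 (u \<times>\<^sub>3 v) = 0" "v \<bullet>\<^sub>3 (u \<times>\<^sub>3 v) = 0"
  "(u \<times>\<^sub>3 v) \<bullet>\<^sub>3 u = 0" "(u \<times>\<^sub>3 v) \<bullet>\<^sub>3 v = 0"
  by (simp_all add: dot3_def crs3_def algebra_simps)

text \<open>Cyclic symmetry of the determinant. It converts
  \<open>(h \<times>\<^sub>3 w) \<bullet>\<^sub>3 e = 1\<close> into a vector
  \<open>e \<times>\<^sub>3 h\<close> on which \<open>h\<close> vanishes and \<open>w\<close> is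
  1.\<close>

lemma dot3_crs3_rotate: "u \<bullet>\<^sub>3 (v \<times>\<^sub>3 w) = w \<bullet>\<^sub>3 (u \<times>\<^sub>3 v)"
  by (simp add: dot3_def crs3_def algebra_simps)

lemma crs3_crs3: "u \<times>\<^sub>3 (v \<times>\<^sub>3 w) = (u \<bullet>\<^sub>3 w) *s v - (u \<bullet>\<^sub>3 v) *s w"
  by (simp add: dot3_def crs3_def vec_eq_iff forall_3 algebra_simps)

text \<open>Replaces positive definiteness: over a finite field a nonzero \<open>u\<close> may
  satisfy \<open>u \<bullet>\<^sub>3 u = 0\<close>.\<close>

lemma dot3_nondegenerate:
  assumes "u \<noteq> 0"
  obtains v where "u \<bullet>\<^sub>3 v = 1"
proof -
  consider "u $ 1 \<noteq> 0" | "u $ 2 \<noteq> 0" | "u $ 3 \<noteq> 0"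
    using assms by (auto simp: vec_eq_iff forall_3)
  then show thesis
    by cases (rule that[of "vector [1 / u $ 1, 0, 0]"] that[of "vector [0, 1 / u $ 2, 0]"]
        that[of "vector [0, 0, 1 / u $ 3]"]; simp add: dot3_def)+
qed

text \<open>Expanding \<open>w \<times>\<^sub>3 (u \<times>\<^sub>3 v)\<close> with
  \<open>v \<bullet>\<^sub>3 w = 1\<close> isolates \<open>u\<close> and yields the factor
  \<open>w \<bullet>\<^sub>3 u\<close>.\<close>

lemma crs3_eq_0_imp_scale:
  assumes "u \<times>\<^sub>3 v = 0" "v \<noteq> 0"
  obtains c where "u = c *s v"
proof -
  obtain w where w: "v \<bullet>\<^sub>3 w = 1" using dot3_nondegenerate[OF assms(2)] .
  have "0 = w \<times>\<^sub>3 (u \<times>\<^sub>3 v)" unfolding assms by (simp add: crs3_def vec_eq_iff forall_3)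
  also have "\<dots> = u - (w \<bullet>\<^sub>3 u) *s v" using w by (simp add: crs3_crs3 dot3_commute)
  finally show thesis using that by simp
qed

text \<open>A nonzero coordinate of \<open>a\<close> is the pivot of the equation; placing it in a
  different free coordinate of each solution makes the two independent.\<close>

lemma exists_orthogonal_pair:
  assumes "a \<noteq> 0"
  obtains u v where "u \<bullet>\<^sub>3 a = 0" "v \<bullet>\<^sub>3 a = 0" "\<And>s t. s *s u + t *s v = 0 \<Longrightarrow> s = 0 \<and> t = 0"
proof -
  consider "a $ 1 \<noteq> 0" | "a $ 2 \<noteq> 0" | "a $ 3 \<noteq> 0"
    using assms by (auto simp: vec_eq_iff forall_3)
  then show thesis
  proof cases
    case 1
    then show ?thesis
      by (intro that[of "vector [- a $ 2, a $ 1, 0]" "vector [- a $ 3, 0, a $ 1]"])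
        (auto simp: dot3_def vec_eq_iff forall_3)
  next
    case 2
    then show ?thesis
      by (intro that[of "vector [a $ 2, - a $ 1, 0]" "vector [0, - a $ 3, a $ 2]"])
        (auto simp: dot3_def vec_eq_iff forall_3)
  next
    case 3
    then show ?thesis
      by (intro that[of "vector [a $ 3, 0, - a $ 1]" "vector [0, a $ 3, - a $ 2]"])
        (auto simp: dot3_def vec_eq_iff forall_3)
  qed
qed

section \<open>The projective and affine planes in coordinates\<close>

definition plane3 :: "'k::field ^ 3 \<Rightarrow> ('k ^ 3) set" where
  "plane3 h = {v. h \<bullet>\<^sub>3 v = 0}"

text \<open>Homogeneous line coordinates: \<open>h\<close> is a normal vector, so joining points and
  intersecting lines both become cross products. For \<open>h = 0\<close> this is the whole plane,
  hence the nonzero assumptions below.\<close>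

definition pline :: "'k::field ^ 3 \<Rightarrow> ('k ^ 3) set set" where
  "pline h = {P \<in> PG_points. P \<subseteq> plane3 h}"

lemma subspace_plane3: "vec.subspace (plane3 h)"
  by (auto simp: vec.subspace_def plane3_def)

text \<open>Squeezed between two bounds: the plane misses \<open>e\<close>, and together with
  \<open>e\<close> it spans everything.\<close>

lemma dim_plane3:
  assumes "h \<noteq> 0"
  shows "vec.dim (plane3 h) = 2"
proof -
  obtain e where e: "h \<bullet>\<^sub>3 e = 1" using dot3_nondegenerate[OF assms] .
  have 3: "vec.dim (UNIV :: ('a ^ 3) set) = 3" by (simp only: vec_dim_card) simp
  have "e \<notin> plane3 h" using e by (simp add: plane3_def)
  then have "vec.span (plane3 h) \<subset> vec.span UNIV"
    unfolding vec.span_eq_iff[THEN iffD2, OF subspace_plane3[of h]] vec.span_UNIV by blast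
  from vec.dim_psubset[OF this] have "vec.dim (plane3 h) < 3" using 3 by simp
  moreover have "v \<in> vec.span (insert e (plane3 h))" for v
  proof -
    have "v - (h \<bullet>\<^sub>3 v) *s e \<in> plane3 h"
      using e dot3_linear(2)[of h "v - (h \<bullet>\<^sub>3 v) *s e" "(h \<bullet>\<^sub>3 v) *s e"] by (simp add: plane3_def)
    then have "(v - (h \<bullet>\<^sub>3 v) *s e) + (h \<bullet>\<^sub>3 v) *s e \<in> vec.span (insert e (plane3 h))"
      by (intro vec.span_add vec.span_scale vec.span_base) auto
    then show ?thesis by simp
  qed
  then have "vec.span (insert e (plane3 h)) = UNIV" by auto
  then have "3 = vec.dim (insert e (plane3 h))" using 3 by (metis vec.dim_span)
  then have "3 \<le> vec.dim (plane3 h) + 1" by (simp add: vec.dim_insert split: if_splits)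
  ultimately show ?thesis by linarith
qed

lemma PG_points_iff: "P \<in> PG_points \<longleftrightarrow> (\<exists>a. a \<noteq> 0 \<and> P = vec.span {a})"
proof
  assume "P \<in> PG_points"
  then have P: "vec.subspace P" "vec.dim P = 1" by (auto simp: PG_points_def)
  obtain B where B: "B \<subseteq> P" "vec.independent B" "P \<subseteq> vec.span B" "card B = vec.dim P"
    by (rule vec.basis_exists)
  then obtain a where a: "B = {a}" using P by (metis card_1_singletonE)
  have "a \<noteq> 0" using B a vec.dependent_zero by blast
  moreover have "P = vec.span {a}" using B a P vec.span_minimal by blast
  ultimately show "\<exists>a. a \<noteq> 0 \<and> P = vec.span {a}" by blast
qed (auto simp: PG_points_def)

lemma span_subset_plane3_iff [simp]: "vec.span {a} \<subseteq> plane3 h \<longleftrightarrow> h \<bullet>\<^sub>3 a = 0"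
proof
  assume "h \<bullet>\<^sub>3 a = 0"
  then show "vec.span {a} \<subseteq> plane3 h"
    by (intro vec.span_minimal subspace_plane3) (simp add: plane3_def)
next
  assume "vec.span {a} \<subseteq> plane3 h"
  then have "a \<in> plane3 h" using vec.span_base by blast
  then show "h \<bullet>\<^sub>3 a = 0" by (simp add: plane3_def)
qed

lemma span_in_pline_iff [simp]: "vec.span {a} \<in> pline h \<longleftrightarrow> a \<noteq> 0 \<and> h \<bullet>\<^sub>3 a = 0"
proof -
  have "a \<noteq> 0" if "vec.span {a} \<in> PG_points" using that by (auto simp: PG_points_def split: if_splits)
  then show ?thesis by (auto simp: pline_def PG_points_iff)
qed

lemma span_scale_eq: "c \<noteq> 0 \<Longrightarrow> vec.span {c *s a} = vec.span {a :: 'k::field ^ 3}"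
  using vec.span_scale[of "c *s a" "{c *s a}" "1 / c"]
  by (intro equalityI vec.span_minimal) (simp_all add: vec.span_scale vec.span_base)

lemma plane3_scale [simp]: "c \<noteq> 0 \<Longrightarrow> plane3 (c *s h) = plane3 h"
  by (simp add: plane3_def)

lemma pline_scale [simp]: "c \<noteq> 0 \<Longrightarrow> pline (c *s h) = pline h"
  by (simp add: pline_def)

lemma crs3_neq_0:
  assumes "a \<noteq> 0" "b \<noteq> 0" "vec.span {a} \<noteq> vec.span {b}"
  shows "a \<times>\<^sub>3 b \<noteq> 0"
proof
  assume "a \<times>\<^sub>3 b = 0"
  then obtain c where "a = c *s b" using crs3_eq_0_imp_scale assms by metis
  then show False using assms span_scale_eq by auto
qed

text \<open>The normal vector is the cross product of a basis of the subspace; the resulting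
  inclusion of planes is an equality by dimension.\<close>

lemma PG_lines_iff: "l \<in> PG_lines \<longleftrightarrow> (\<exists>h. h \<noteq> 0 \<and> l = pline h)"
proof
  assume "l \<in> PG_lines"
  then obtain W where W: "vec.subspace W" "vec.dim W = 2" "l = {P \<in> PG_points. P \<subseteq> W}"
    by (auto simp: PG_lines_def)
  obtain B where B: "B \<subseteq> W" "vec.independent B" "W \<subseteq> vec.span B" "card B = vec.dim W"
    by (rule vec.basis_exists)
  then obtain a b where ab: "B = {a, b}" "a \<noteq> b" using W by (metis card_2_iff)
  have b0: "b \<noteq> 0" using B ab vec.dependent_zero by blast
  define h where "h = a \<times>\<^sub>3 b"
  have h0: "h \<noteq> 0"
  proof
    assume "h = 0"
    then obtain c where "a = c *s b" using crs3_eq_0_imp_scale b0 unfolding h_def by metis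
    then have "a \<in> vec.span {b}" by (auto simp: vec.span_singleton)
    then show False using B(2) ab by (auto simp: vec.independent_insert)
  qed
  have "W \<subseteq> plane3 h"
    using B(3) vec.span_minimal[OF _ subspace_plane3, of B h] ab
    by (auto simp: plane3_def h_def)
  then have "W = plane3 h"
    using vec.subspace_dim_equal[OF W(1) subspace_plane3] W dim_plane3[OF h0] by simp
  then show "\<exists>h. h \<noteq> 0 \<and> l = pline h" using h0 W by (auto simp: pline_def)
next
  assume "\<exists>h. h \<noteq> 0 \<and> l = pline h"
  then show "l \<in> PG_lines"
    using subspace_plane3 dim_plane3 by (auto simp: PG_lines_def pline_def)
qed

lemma PG_line_through:
  assumes "P \<in> PG_points" "Q \<in> PG_points" "P \<noteq> Q"
  shows "\<exists>l\<in>PG_lines. P \<in> l \<and> Q \<in> l"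
proof -
  obtain a b where "a \<noteq> 0" "P = vec.span {a}" "b \<noteq> 0" "Q = vec.span {b}"
    using assms by (auto simp: PG_points_iff)
  then show ?thesis using assms crs3_neq_0[of a b]
    by (intro bexI[of _ "pline (a \<times>\<^sub>3 b)"]) (auto simp: PG_lines_iff)
qed

lemma PG_line_unique:
  assumes "P \<in> l" "Q \<in> l" "P \<in> l'" "Q \<in> l'" "P \<noteq> Q" "l \<in> PG_lines" "l' \<in> PG_lines"
  shows "l = l'"
proof -
  have "P \<in> PG_points" "Q \<in> PG_points" using assms by (auto simp: PG_lines_def)
  then obtain a b where ab: "a \<noteq> 0" "P = vec.span {a}" "b \<noteq> 0" "Q = vec.span {b}"
    by (auto simp: PG_points_iff)
  have "k = pline (a \<times>\<^sub>3 b)" if k: "k \<in> PG_lines" "P \<in> k" "Q \<in> k" for k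
  proof -
    obtain h where h: "h \<noteq> 0" "k = pline h" using k by (auto simp: PG_lines_iff)
    then have "h \<bullet>\<^sub>3 a = 0" "h \<bullet>\<^sub>3 b = 0" using k ab by auto
    then have "h \<times>\<^sub>3 (a \<times>\<^sub>3 b) = 0" by (simp add: crs3_crs3)
    then obtain c where "h = c *s (a \<times>\<^sub>3 b)"
      using crs3_eq_0_imp_scale crs3_neq_0 ab assms(5) by metis
    then show ?thesis using h by auto
  qed
  then show ?thesis using assms by metis
qed

lemma PG_lines_meet:
  assumes "l \<in> PG_lines" "l' \<in> PG_lines"
  shows "l \<inter> l' \<noteq> {}"
proof -
  obtain h k where hk: "h \<noteq> 0" "l = pline h" "k \<noteq> 0" "l' = pline k"
    using assms by (auto simp: PG_lines_iff)
  obtain n where n: "n \<noteq> 0" "h \<bullet>\<^sub>3 n = 0" "k \<bullet>\<^sub>3 n = 0"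
  \<comment> \<open>Proportional normals describe the same line, where any point will do; otherwise
    the cross product is the point of intersection.\<close>
  proof (cases "h \<times>\<^sub>3 k = 0")
    case True
    then obtain c where "h = c *s k" using crs3_eq_0_imp_scale hk by metis
    moreover obtain u v where "u \<bullet>\<^sub>3 k = 0" "\<And>s t. s *s u + t *s v = 0 \<Longrightarrow> s = 0 \<and> t = 0"
      using exists_orthogonal_pair[OF hk(3)] by metis
    moreover from this(2)[of 1 0] have "u \<noteq> 0" by auto
    ultimately show thesis using that[of u] by (simp add: dot3_commute)
  next
    case False
    then show thesis using that[of "h \<times>\<^sub>3 k"] by simp
  qed
  then have "vec.span {n} \<in> l \<inter> l'" using hk by simp
  then show ?thesis by blast
qed

text \<open>If the normals are not proportional, \<open>e \<times>\<^sub>3 h\<close> is a point on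
  the first line and off the second.\<close>

lemma pline_eq_iff:
  assumes "h \<noteq> 0" "k \<noteq> 0"
  shows "pline h = pline k \<longleftrightarrow> h \<times>\<^sub>3 k = 0"
proof
  assume eq: "pline h = pline k"
  show "h \<times>\<^sub>3 k = 0"
  proof (rule ccontr)
    assume "h \<times>\<^sub>3 k \<noteq> 0"
    then obtain e where "(h \<times>\<^sub>3 k) \<bullet>\<^sub>3 e = 1" using dot3_nondegenerate by metis
    then have *: "k \<bullet>\<^sub>3 (e \<times>\<^sub>3 h) = 1"
      by (metis dot3_commute dot3_crs3_rotate)
    then have "e \<times>\<^sub>3 h \<noteq> 0" by auto
    then have "vec.span {e \<times>\<^sub>3 h} \<in> pline h" by simp
    then show False using * unfolding eq by simp
  qed
next
  assume "h \<times>\<^sub>3 k = 0"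
  then obtain c where "h = c *s k" using crs3_eq_0_imp_scale assms by metis
  then show "pline h = pline k" using assms by auto
qed

text \<open>The affine chart: fixing the value of \<open>w\<close> removes the projective scaling,
  so vectors can be subtracted and compared.\<close>

lemma AG_point_normalized:
  assumes "P \<in> AG_points (pline w)"
  obtains a where "P = vec.span {a}" "w \<bullet>\<^sub>3 a = 1"
proof -
  obtain b where b: "b \<noteq> 0" "P = vec.span {b}" "w \<bullet>\<^sub>3 b \<noteq> 0"
    using assms by (auto simp: AG_points_def PG_points_iff)
  then show thesis
    using that[of "(1 / (w \<bullet>\<^sub>3 b)) *s b"] by (simp add: span_scale_eq)
qed

lemma span_in_AG_points:
  assumes "w \<bullet>\<^sub>3 a = 1"
  shows "vec.span {a} \<in> AG_points (pline w)"
proof -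
  have "a \<noteq> 0" using assms by auto
  then have "vec.span {a} \<in> PG_points" unfolding PG_points_iff by blast
  then show ?thesis using assms by (simp add: AG_points_def)
qed

lemma AG_line_coordinates:
  assumes "l \<in> AG_lines (pline w)" "w \<noteq> 0"
  obtains h where "h \<times>\<^sub>3 w \<noteq> 0" "l = pline h - pline w"
proof -
  obtain h where "h \<noteq> 0" "l = pline h - pline w" "pline h \<noteq> pline w"
    using assms by (auto simp: AG_lines_def PG_lines_iff)
  then show thesis using that pline_eq_iff assms(2) by metis
qed

lemma AG_line_card:
  fixes m :: "('k::{field,finite} ^ 3) set set"
  assumes "m \<in> PG_lines" "l \<in> AG_lines m"
  shows "card l = CARD('k)"
proof -
  obtain w where w: "w \<noteq> 0" "m = pline w" using assms by (auto simp: PG_lines_iff)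
  then obtain h where h: "h \<times>\<^sub>3 w \<noteq> 0" "l = pline h - pline w"
    using AG_line_coordinates assms by metis
  \<comment> \<open>The direction of the line: \<open>vec.span {n}\<close> is its point at infinity,
    and its affine points are those of \<open>a + t *s n\<close>.\<close>
  define n where "n = h \<times>\<^sub>3 w"
  obtain e where "n \<bullet>\<^sub>3 e = 1" using dot3_nondegenerate h n_def by metis
  then have "w \<bullet>\<^sub>3 (e \<times>\<^sub>3 h) = 1"
    unfolding n_def by (metis dot3_commute dot3_crs3_rotate)
  then obtain a where a: "w \<bullet>\<^sub>3 a = 1" "h \<bullet>\<^sub>3 a = 0" using that by fastforce
  have wn: "w \<bullet>\<^sub>3 (a + t *s n) = 1" "h \<bullet>\<^sub>3 (a + t *s n) = 0" for t
    using a by (simp_all add: n_def)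
  have inj: "inj (\<lambda>t. vec.span {a + t *s n})"
  proof
    fix s t assume eq: "vec.span {a + s *s n} = vec.span {a + t *s n}"
    have "a + s *s n \<in> vec.span {a + t *s n}" using eq vec.span_base by blast
    then obtain c where c: "a + s *s n = c *s (a + t *s n)"
      by (auto simp: vec.span_singleton)
    then have "w \<bullet>\<^sub>3 (a + s *s n) = c * (w \<bullet>\<^sub>3 (a + t *s n))" by (simp only: dot3_linear(4))
    then have "c = 1" unfolding wn by simp
    with c have "(s - t) *s n = 0" by (simp add: vec.scale_left_diff_distrib)
    then show "s = t" using h n_def by simp
  qed
  have "range (\<lambda>t. vec.span {a + t *s n}) = l"
  proof (intro equalityI subsetI)
    fix P assume "P \<in> range (\<lambda>t. vec.span {a + t *s n})"
    then obtain t where "P = vec.span {a + t *s n}" by auto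
    moreover have "a + t *s n \<noteq> 0" using wn(1)[of t] by (metis dot3_linear(5) zero_neq_one)
    ultimately show "P \<in> l" using wn[of t] h by simp
  next
    fix P assume P: "P \<in> l"
    then have "P \<in> AG_points (pline w)" using h by (auto simp: AG_points_def pline_def)
    then obtain b where b: "P = vec.span {b}" "w \<bullet>\<^sub>3 b = 1" by (rule AG_point_normalized)
    have hb: "h \<bullet>\<^sub>3 b = 0" using P b h by simp
    have "h \<bullet>\<^sub>3 (b - a) = 0" "w \<bullet>\<^sub>3 (b - a) = 0"
      using a b hb dot3_linear(2)[of h "b - a" a] dot3_linear(2)[of w "b - a" a] by auto
    then have "(b - a) \<times>\<^sub>3 n = 0" by (simp add: n_def crs3_crs3 dot3_commute)
    then obtain c where "b - a = c *s n" using crs3_eq_0_imp_scale h n_def by metis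
    then have "b = a + c *s n" by (simp add: algebra_simps)
    then show "P \<in> range (\<lambda>t. vec.span {a + t *s n})" using b by auto
  qed
  then show ?thesis using card_image[OF inj] by simp
qed

lemma AG_point_off_line:
  assumes "m \<in> PG_lines" "l \<in> AG_lines m"
  shows "\<exists>P\<in>AG_points m. P \<notin> l"
proof -
  obtain w where w: "w \<noteq> 0" "m = pline w" using assms by (auto simp: PG_lines_iff)
  then obtain h where h: "h \<times>\<^sub>3 w \<noteq> 0" "l = pline h - pline w"
    using AG_line_coordinates assms by metis
  obtain e where "(h \<times>\<^sub>3 w) \<bullet>\<^sub>3 e = 1" using dot3_nondegenerate h by metis
  then have "h \<bullet>\<^sub>3 (w \<times>\<^sub>3 e) = 1"
    by (metis dot3_commute dot3_crs3_rotate)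
  \<comment> \<open>A direction transversal to the line: adding \<open>d\<close> keeps a point in
    the chart and changes the value of \<open>h\<close>.\<close>
  then obtain d where d: "h \<bullet>\<^sub>3 d = 1" "w \<bullet>\<^sub>3 d = 0" using that by fastforce
  obtain a where a: "w \<bullet>\<^sub>3 a = 1" using dot3_nondegenerate w by metis
  obtain b where b: "w \<bullet>\<^sub>3 b = 1" "h \<bullet>\<^sub>3 b \<noteq> 0"
  proof (cases "h \<bullet>\<^sub>3 a = 0")
    case True
    then show thesis using that[of "a + d"] a d by simp
  qed (use a that in auto)
  then show ?thesis using w h span_in_AG_points[OF b(1)] by (intro bexI[of _ "vec.span {b}"]) auto
qed

text \<open>The theorem of Jamison and of Brouwer and Schrijver for the blocking set \<open>insert x T\<close>.
  With affine points normalized by \<open>w \<bullet>\<^sub>3 a = 1\<close>, where \<open>m\<close> is the line of \<open>w\<close>, the lines other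
  than \<open>m\<close> missing \<open>x\<close> are those of \<open>w + u\<close> for nonzero \<open>u\<close> orthogonal to \<open>x\<close>. So the product of
  the forms \<open>(w + u) \<bullet>\<^sub>3 b\<close> over \<open>b \<in> T\<close> vanishes at all such \<open>u\<close> but is 1 at \<open>u = 0\<close>; its sum over
  all \<open>u\<close> is therefore 1, which is impossible for a polynomial in two variables of low degree.\<close>

lemma card_cover_lines_missing_point:
  fixes m :: "('k::{field,finite} ^ 3) set set"
  assumes m: "m \<in> PG_lines" and x: "x \<in> AG_points m" and T: "T \<subseteq> AG_points m"
    and cover: "\<And>l. \<lbrakk>l \<in> AG_lines m; x \<notin> l\<rbrakk> \<Longrightarrow> T \<inter> l \<noteq> {}"
  shows "2 * (CARD('k) - 1) \<le> card T"
proof (rule ccontr)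
  assume "\<not> 2 * (CARD('k) - 1) \<le> card T"
  obtain w where w: "w \<noteq> 0" "m = pline w" using m by (auto simp: PG_lines_iff)
  obtain a where a: "x = vec.span {a}" "w \<bullet>\<^sub>3 a = 1" using AG_point_normalized x w by metis
  then have "a \<noteq> 0" by auto
  then obtain u v where uv: "u \<bullet>\<^sub>3 a = 0" "v \<bullet>\<^sub>3 a = 0" "\<And>s t. s *s u + t *s v = 0 \<Longrightarrow> s = 0 \<and> t = 0"
    using exists_orthogonal_pair by metis
  have "\<forall>P\<in>T. \<exists>b. P = vec.span {b} \<and> w \<bullet>\<^sub>3 b = 1"
    using T w AG_point_normalized by (metis subsetD)
  then obtain \<rho> where \<rho>: "\<And>P. P \<in> T \<Longrightarrow> P = vec.span {\<rho> P} \<and> w \<bullet>\<^sub>3 \<rho> P = 1"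
    by metis
  define F where "F s t = (\<Prod>P\<in>T. 1 + s * (u \<bullet>\<^sub>3 \<rho> P) + t * (v \<bullet>\<^sub>3 \<rho> P))" for s t
  \<comment> \<open>The nested form lets the inner and the outer sum collapse separately.\<close>
  have F0: "F s t = (if t = 0 then if s = 0 then 1 else 0 else 0)" for s t
  proof (cases "s = 0 \<and> t = 0")
    case False
    define h where "h = w + s *s u + t *s v"
    have ha: "h \<bullet>\<^sub>3 a = 1" using a uv by (simp add: h_def)
    then have h0: "h \<noteq> 0" by auto
    \<comment> \<open>Both \<open>h\<close> and \<open>w\<close> are 1 at \<open>a\<close>, so
      proportionality would force \<open>h = w\<close>, against the independence of \<open>u\<close>
      and \<open>v\<close>.\<close>
    have "pline h \<noteq> pline w"
    proof
      assume "pline h = pline w"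
      then have "h \<times>\<^sub>3 w = 0" using pline_eq_iff h0 w by metis
      then obtain c where c: "h = c *s w" using crs3_eq_0_imp_scale w by metis
      with ha a have "c = 1" by simp
      with c have "s *s u + t *s v = 0" by (simp add: h_def add.assoc)
      with uv False show False by blast
    qed
    then have "pline h - m \<in> AG_lines m"
      using h0 w by (auto simp: AG_lines_def PG_lines_iff)
    moreover have "x \<notin> pline h - m" using a ha by simp
    ultimately obtain P where P: "P \<in> T" "P \<in> pline h" using cover by blast
    then have "h \<bullet>\<^sub>3 \<rho> P = 0" using \<rho> by (metis span_in_pline_iff)
    then have "1 + s * (u \<bullet>\<^sub>3 \<rho> P) + t * (v \<bullet>\<^sub>3 \<rho> P) = 0"
      using \<rho>[OF P(1)] by (simp add: h_def)
    then show ?thesis using False P(1) by (auto simp: F_def)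
  qed (simp add: F_def)
  have "(\<Sum>s\<in>UNIV. \<Sum>t\<in>UNIV. F s t) = 1"
    unfolding F0 by simp
  moreover have "(\<Sum>s\<in>UNIV. \<Sum>t\<in>UNIV. F s t) = 0"
    using sum_monomial_prod_affine_eq_0[of T 0 0 "\<lambda>P. u \<bullet>\<^sub>3 \<rho> P" "\<lambda>P. v \<bullet>\<^sub>3 \<rho> P"]
      \<open>\<not> 2 * (CARD('k) - 1) \<le> card T\<close> by (simp add: F_def)
  ultimately show False by simp
qed

section \<open>Parallel classes in affine planes\<close>

lemma parallel_sym: "parallel l l' \<Longrightarrow> parallel l' l"
  by (auto simp: parallel_def)

text \<open>The order is a parameter because two planes over different fields are needed, of orders
  \<open>p\<close> and \<open>p - 1\<close>.\<close>

locale affine_plane =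
  fixes Pt :: "'a set" and Ln :: "'a set set" and n :: nat
  assumes n_ge_2: "2 \<le> n"
    and line_subset: "l \<in> Ln \<Longrightarrow> l \<subseteq> Pt"
    and line_card: "l \<in> Ln \<Longrightarrow> card l = n"
    and line_through: "\<lbrakk>y \<in> Pt; z \<in> Pt; y \<noteq> z\<rbrakk> \<Longrightarrow> \<exists>l\<in>Ln. y \<in> l \<and> z \<in> l"
    and line_unique: "\<lbrakk>y \<in> l; z \<in> l; y \<in> l'; z \<in> l'; y \<noteq> z; l \<in> Ln; l' \<in> Ln\<rbrakk> \<Longrightarrow> l = l'"
    and parallel_through: "\<lbrakk>y \<in> Pt; l \<in> Ln\<rbrakk> \<Longrightarrow> \<exists>l'\<in>Ln. y \<in> l' \<and> parallel l l'"
    and parallel_unique: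
      "\<lbrakk>l \<in> Ln; l1 \<in> Ln; l2 \<in> Ln; parallel l l1; parallel l l2; y \<in> l1; y \<in> l2\<rbrakk> \<Longrightarrow> l1 = l2"
    and point_off_line: "l \<in> Ln \<Longrightarrow> \<exists>y\<in>Pt. y \<notin> l"
begin

definition pclass :: "'a set \<Rightarrow> 'a set set" where
  "pclass l = {l' \<in> Ln. parallel l l'}"

lemma line_nonempty: "l \<in> Ln \<Longrightarrow> l \<noteq> {}"
  using line_card n_ge_2 by fastforce

text \<open>If \<open>l1\<close> and \<open>l3\<close> share a point, both are the parallel to
  \<open>l2\<close> through it, hence equal.\<close>

lemma parallel_trans:
  assumes "l1 \<in> Ln" "l2 \<in> Ln" "l3 \<in> Ln" "parallel l1 l2" "parallel l2 l3"
  shows "parallel l1 l3"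
  using assms parallel_unique[of l2 l1 l3] parallel_sym[of l1 l2]
  by (cases "l1 \<inter> l3 = {}") (auto simp: parallel_def)

lemma pclass_parallel:
  assumes "l \<in> Ln" "l1 \<in> pclass l" "l2 \<in> pclass l"
  shows "parallel l1 l2"
  using assms parallel_trans[of l1 l l2] parallel_sym by (auto simp: pclass_def)

lemma pclass_eq: "\<lbrakk>l \<in> Ln; l' \<in> pclass l\<rbrakk> \<Longrightarrow> pclass l' = pclass l"
  using parallel_trans parallel_sym unfolding pclass_def by blast

lemma pclass_disjoint: "l \<in> Ln \<Longrightarrow> disjoint (pclass l)"
  using pclass_parallel by (auto simp: disjoint_def parallel_def)

lemma Union_pclass: "l \<in> Ln \<Longrightarrow> \<Union> (pclass l) = Pt"
  using parallel_through line_subset by (fastforce simp: pclass_def)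

text \<open>A line \<open>k\<close> not parallel to \<open>l\<close> meets every line of the class
  exactly once, so the class is in bijection with the points of \<open>k\<close>.\<close>

lemma card_pclass:
  assumes l: "l \<in> Ln"
  shows "card (pclass l) = n"
proof -
  obtain y z where y: "y \<in> Pt" "y \<notin> l" and z: "z \<in> l"
    using point_off_line line_nonempty l by (metis ex_in_conv)
  then obtain k where k: "k \<in> Ln" "y \<in> k" "z \<in> k"
    using line_through line_subset l by (metis subsetD)
  have npar: "\<not> parallel l k" using k y z by (auto simp: parallel_def)
  have "\<exists>l'\<in>pclass l. v \<in> l'" if "v \<in> k" for v
    using that k Union_pclass[OF l] line_subset by blast
  then obtain f where f: "\<And>v. v \<in> k \<Longrightarrow> f v \<in> pclass l \<and> v \<in> f v" by metis
  have "bij_betw f k (pclass l)"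
    unfolding bij_betw_def
  proof
    have npar_k: "l' \<noteq> k \<and> l' \<inter> k \<noteq> {}" if l': "l' \<in> pclass l" for l'
      using that npar pclass_def parallel_trans[of l l' k] l k by (auto simp: parallel_def)
    show "inj_on f k"
      using f npar_k k line_unique unfolding inj_on_def pclass_def by (metis (lifting) mem_Collect_eq)
    show "f ` k = pclass l"
    proof (intro equalityI subsetI)
      fix l' assume l': "l' \<in> pclass l"
      then obtain v where v: "v \<in> l'" "v \<in> k" using npar_k by blast
      then have "f v = l'" using pclass_disjoint[OF l] f l' by (auto simp: disjoint_def)
      then show "l' \<in> f ` k" using v by blast
    qed (use f in auto)
  qed
  then show ?thesis using bij_betw_same_card line_card k by metis
qed

lemma pclass_eq_if_parallel:
  assumes "C \<in> pclass ` Ln" "C' \<in> pclass ` Ln" "l \<in> C" "l' \<in> C'" "parallel l l'"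
  shows "C = C'"
proof -
  have "C = pclass l" "C' = pclass l'" using assms pclass_eq by auto
  moreover have "l \<in> Ln" "l' \<in> Ln" using assms by (auto simp: pclass_def)
  then have "pclass l' = pclass l" using assms(5) by (intro pclass_eq) (auto simp: pclass_def)
  ultimately show ?thesis by simp
qed

end

lemma AG_line_subset: "l \<in> AG_lines m \<Longrightarrow> l \<subseteq> AG_points m"
  by (auto simp: AG_lines_def AG_points_def PG_lines_def)

lemma CARD_field_ge_2: "2 \<le> CARD('k::{field,finite})"
proof -
  have "card {0, 1 :: 'k} \<le> CARD('k)" by (intro card_mono) auto
  then show ?thesis by simp
qed

text \<open>\<open>z\<close> is the point at infinity of \<open>k\<close>. Distinct projective lines
  meet exactly once, so their affine parts are disjoint iff that point lies on \<open>m\<close>. The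
  parallel through \<open>y\<close> is thus the line joining \<open>y\<close> to
  \<open>z\<close>.\<close>

lemma AG_parallel_iff:
  fixes m :: "('k::{field,finite} ^ 3) set set"
  assumes "m \<in> PG_lines" "k \<in> PG_lines" "k' \<in> PG_lines"
    and z: "z \<in> k" "z \<in> m" and "k \<noteq> m" "k' \<noteq> m"
  shows "parallel (k - m) (k' - m) \<longleftrightarrow> z \<in> k'"
proof
  assume "z \<in> k'"
  show "parallel (k - m) (k' - m)"
  proof (rule ccontr)
    assume "\<not> ?thesis"
    then obtain y where "y \<in> k" "y \<in> k'" "y \<notin> m" "k \<noteq> k'" by (auto simp: parallel_def)
    then show False using assms \<open>z \<in> k'\<close> PG_line_unique[of y k z k'] by auto
  qed
next
  assume par: "parallel (k - m) (k' - m)"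
  obtain v where v: "v \<in> k" "v \<in> k'" using PG_lines_meet assms by blast
  obtain u where u: "u \<in> k'" "u \<in> m" using PG_lines_meet assms by blast
  show "z \<in> k'"
  proof (cases "v \<in> m")
    case True
    then show ?thesis using PG_line_unique[of v k z m] v assms by metis
  next
    case False
    then have "k - m = k' - m" using par v by (auto simp: parallel_def)
    moreover have "card (k - m) = CARD('k)"
      using AG_line_card assms by (auto simp: AG_lines_def)
    \<comment> \<open>Two common affine points suffice to identify the projective lines.\<close>
    then have "\<not> card (k - m) \<le> Suc 0" using CARD_field_ge_2[where 'k = 'k] by simp
    then obtain a b where "a \<in> k - m" "b \<in> k - m" "a \<noteq> b"
      by (metis card_le_Suc0_iff_eq finite)
    ultimately have "k = k'" using assms by (intro PG_line_unique[of a k b k']) auto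
    then show ?thesis using z by simp
  qed
qed

lemma AG_affine_plane:
  fixes m :: "('k::{field,finite} ^ 3) set set"
  assumes m: "m \<in> PG_lines"
  shows "affine_plane (AG_points m) (AG_lines m) CARD('k)"
proof
  show "2 \<le> CARD('k)" by (rule CARD_field_ge_2)
next
  fix l assume "l \<in> AG_lines m"
  then show "l \<subseteq> AG_points m" "card l = CARD('k)" "\<exists>y\<in>AG_points m. y \<notin> l"
    using AG_line_subset AG_line_card AG_point_off_line m by auto
next
  fix y z assume "y \<in> AG_points m" "z \<in> AG_points m" "y \<noteq> z"
  moreover from this obtain k where "k \<in> PG_lines" "y \<in> k" "z \<in> k"
    using PG_line_through by (auto simp: AG_points_def)
  ultimately show "\<exists>l\<in>AG_lines m. y \<in> l \<and> z \<in> l"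
    by (intro bexI[of _ "k - m"]) (auto simp: AG_lines_def AG_points_def)
next
  fix y z l l'
  assume "y \<in> l" "z \<in> l" "y \<in> l'" "z \<in> l'" "y \<noteq> z" "l \<in> AG_lines m" "l' \<in> AG_lines m"
  then show "l = l'" using PG_line_unique[of y _ z] unfolding AG_lines_def by blast
next
  fix y l assume y: "y \<in> AG_points m" and "l \<in> AG_lines m"
  then obtain k where k: "k \<in> PG_lines" "k \<noteq> m" "l = k - m" by (auto simp: AG_lines_def)
  then obtain z where z: "z \<in> k" "z \<in> m" using PG_lines_meet m by blast
  have "z \<in> PG_points" using k z by (auto simp: PG_lines_def)
  moreover have y': "y \<in> PG_points" "y \<notin> m" using y by (auto simp: AG_points_def)
  moreover have "y \<noteq> z" using y' z by auto
  ultimately obtain k' where k': "k' \<in> PG_lines" "y \<in> k'" "z \<in> k'" using PG_line_through by blast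
  then have "k' \<noteq> m" using y' by auto
  then have "parallel l (k' - m)" using AG_parallel_iff[OF m _ _ z] k k' by simp
  then show "\<exists>l'\<in>AG_lines m. y \<in> l' \<and> parallel l l'"
    using k' y' \<open>k' \<noteq> m\<close> by (intro bexI[of _ "k' - m"]) (auto simp: AG_lines_def)
next
  fix l l1 l2 y
  assume *: "l \<in> AG_lines m" "l1 \<in> AG_lines m" "l2 \<in> AG_lines m"
    "parallel l l1" "parallel l l2" "y \<in> l1" "y \<in> l2"
  then obtain k k1 k2 where k: "k \<in> PG_lines" "k \<noteq> m" "l = k - m"
    "k1 \<in> PG_lines" "k1 \<noteq> m" "l1 = k1 - m" "k2 \<in> PG_lines" "k2 \<noteq> m" "l2 = k2 - m"
    by (auto simp: AG_lines_def)
  then obtain z where z: "z \<in> k" "z \<in> m" using PG_lines_meet m by blast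
  then have "z \<in> k1" "z \<in> k2" using AG_parallel_iff[OF m _ _ z] k * by auto
  then have "k1 = k2" using PG_line_unique[of y k1 z k2] k * z by auto
  then show "l1 = l2" using k by simp
qed

section \<open>The hypergraph \<open>\<G>\<^sub>r\<close>\<close>

lemma card_le_card_transversal:
  assumes "disjoint C" "finite T" "\<And>l. l \<in> C \<Longrightarrow> T \<inter> l \<noteq> {}"
  shows "card C \<le> card T"
proof -
  obtain f where f: "\<And>l. l \<in> C \<Longrightarrow> f l \<in> T \<and> f l \<in> l" using assms(3) by (metis disjoint_iff)
  have "inj_on f C"
  proof (rule inj_onI)
    fix l l' assume "l \<in> C" "l' \<in> C" "f l = f l'"
    then have "f l \<in> l \<inter> l'" using f by (metis IntI)
    then show "l = l'" using assms(1) \<open>l \<in> C\<close> \<open>l' \<in> C\<close> by (auto simp: disjoint_def)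
  qed
  moreover have "f ` C \<subseteq> T" using f by blast
  ultimately show ?thesis using assms(2) card_inj_on_le by blast
qed

lemma card_add_le:
  assumes "finite T" "S \<subseteq> T" "S' \<subseteq> T" "S \<inter> S' = {}"
  shows "card S + card S' \<le> card T"
proof -
  have "card S + card S' = card (S \<union> S')"
    using assms by (intro card_Un_disjoint[symmetric]) (auto intro: finite_subset)
  also have "\<dots> \<le> card T" using assms by (intro card_mono) auto
  finally show ?thesis .
qed

lemma Inr_in_copy [simp]: "Inr (i, y) \<in> copy j S \<longleftrightarrow> i = j \<and> y \<in> S"
  by (auto simp: copy_def)

lemma Inl_notin_copy [simp]: "Inl v \<notin> copy j S"
  by (auto simp: copy_def)

lemma card_copy [simp]: "card (copy i S) = card S"
  by (simp add: copy_def card_image inj_on_def)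

locale G_construction =
  fixes p :: nat
    and m :: "('k::{field,finite} ^ 3) set set" and x :: "('k ^ 3) set"
    and L :: "nat \<Rightarrow> ('k ^ 3) set set"
    and m' :: "('l::{field,finite} ^ 3) set set" and B :: "('l ^ 3) set set set"
    and \<sigma> :: "nat \<Rightarrow> ('l ^ 3) set set \<Rightarrow> nat"
    and \<phi> :: "nat \<Rightarrow> ('k ^ 3) set set \<Rightarrow> ('l ^ 3) set set set"
  assumes CARD_k: "CARD('k) = p" and CARD_l: "CARD('l) = p - 1"
    and m: "m \<in> PG_lines" and x: "x \<in> AG_points m"
    and bij_L: "bij_betw L {1..p+1} {l \<in> AG_lines m. x \<in> l}"
    and m': "m' \<in> PG_lines" and B: "B \<in> AG_parallel_classes m'"
    and bij_\<sigma>: "\<And>i. i \<in> {1..p+1} \<Longrightarrow> bij_betw (\<sigma> i) B ({i} \<union> {p+2..2*p-1})"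
    and bij_\<phi>: "\<And>i. i \<in> {1..p+1} \<Longrightarrow>
           bij_betw (\<phi> i) (A_edge_class m x (L i)) (J_edge_classes m' B)"
begin

sublocale A: affine_plane "AG_points m" "AG_lines m" p
  using AG_affine_plane[OF m] CARD_k by simp

sublocale J: affine_plane "AG_points m'" "AG_lines m'" "p - 1"
  using AG_affine_plane[OF m'] CARD_l by simp

lemma p_ge_3: "3 \<le> p"
  using J.n_ge_2 by simp

abbreviation G where "G \<equiv> G_hyp p m x L m' B \<phi>"
abbreviation V where "V \<equiv> G_class p x L B \<sigma>"

lemma AG_parallel_classes_eq: "AG_parallel_classes m' = J.pclass ` AG_lines m'"
  by (auto simp: AG_parallel_classes_def J.pclass_def)

lemma B_pclass: "B \<in> J.pclass ` AG_lines m'"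
  using B AG_parallel_classes_eq by simp

lemma B_partition: "\<Union>B = AG_points m'" "disjoint B"
  using B_pclass J.Union_pclass J.pclass_disjoint by auto

lemma B_line: "b \<in> B \<Longrightarrow> b \<in> AG_lines m'"
  using B_pclass by (auto simp: J.pclass_def)

lemma L_line: "i \<in> {1..p+1} \<Longrightarrow> L i \<in> AG_lines m \<and> x \<in> L i"
  using bij_betw_apply[OF bij_L] by blast

lemma L_surj:
  assumes "l \<in> AG_lines m" "x \<in> l"
  obtains i where "i \<in> {1..p+1}" "L i = l"
proof -
  have "l \<in> L ` {1..p+1}" using assms bij_betw_imp_surj_on[OF bij_L] by simp
  then show thesis using that by blast
qed

lemma A_edge_class_iff:
  "e \<in> A_edge_class m x l \<longleftrightarrow> e \<in> AG_lines m \<and> x \<notin> e \<and> parallel e l"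
  by (auto simp: A_edge_class_def A_hyp_def)

text \<open>Parallels to \<open>L i\<close> other than itself are disjoint from it, so they avoid
  \<open>x\<close>.\<close>

lemma A_edge_class_eq:
  assumes "i \<in> {1..p+1}"
  shows "A_edge_class m x (L i) = A.pclass (L i) - {L i}"
  using L_line[OF assms] A.line_nonempty
  by (auto simp: A_edge_class_iff A.pclass_def parallel_def)

lemma card_A_edge_class:
  assumes "i \<in> {1..p+1}"
  shows "card (A_edge_class m x (L i)) = p - 1"
proof -
  have "L i \<in> A.pclass (L i)" using L_line[OF assms] by (simp add: A.pclass_def parallel_def)
  then show ?thesis using A_edge_class_eq A.card_pclass L_line assms by simp
qed

lemma disjoint_A_edge_class:
  assumes "i \<in> {1..p+1}"
  shows "disjoint (A_edge_class m x (L i))"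
  using A.pclass_disjoint[of "L i"] L_line[OF assms] A_edge_class_eq[OF assms]
  by (auto simp: disjoint_def)

lemma edge_class_exists:
  assumes "e \<in> AG_lines m" "x \<notin> e"
  shows "\<exists>i\<in>{1..p+1}. e \<in> A_edge_class m x (L i)"
proof -
  obtain l where "l \<in> AG_lines m" "x \<in> l" "parallel e l" using A.parallel_through x assms by blast
  moreover from this obtain i where "i \<in> {1..p+1}" "L i = l"
    using L_surj by metis
  ultimately show ?thesis using assms by (auto simp: A_edge_class_iff)
qed

lemma \<phi>_pclass:
  assumes "i \<in> {1..p+1}" "e \<in> A_edge_class m x (L i)"
  shows "\<phi> i e \<in> J.pclass ` AG_lines m'" "\<phi> i e \<noteq> B"
  using bij_betw_apply[OF bij_\<phi>[OF assms(1)] assms(2)]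
  by (auto simp: J_edge_classes_def AG_parallel_classes_eq)

lemma \<phi>_line:
  assumes "i \<in> {1..p+1}" "e \<in> A_edge_class m x (L i)" "f \<in> \<phi> i e"
  shows "f \<in> AG_lines m'"
  using \<phi>_pclass(1)[OF assms(1,2)] assms(3) by (auto simp: J.pclass_def)

lemma edge_cases:
  assumes "E \<in> edges G"
  obtains i e f where "i \<in> {1..p+1}" "e \<in> A_edge_class m x (L i)" "f \<in> \<phi> i e"
    "E = Inl ` e \<union> copy i f"
  using assms by (auto simp: G_hyp_def)

lemma Inl_in_verts: "Inl v \<in> verts G \<longleftrightarrow> v \<in> AG_points m \<and> v \<noteq> x"
  by (auto simp: G_hyp_def A_hyp_def)

lemma Inr_in_verts: "Inr (i, y) \<in> verts G \<longleftrightarrow> i \<in> {1..p+1} \<and> y \<in> AG_points m'"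
  by (auto simp: G_hyp_def J_hyp_def)

lemma Inl_in_V: "Inl v \<in> V j \<longleftrightarrow> j \<le> p + 1 \<and> v \<in> L j \<and> v \<noteq> x"
  by (auto simp: G_class_def)

lemma Inr_in_V: "Inr (i, y) \<in> V j \<longleftrightarrow> i \<in> {1..p+1} \<and> (\<exists>b\<in>B. \<sigma> i b = j \<and> y \<in> b)"
  by (auto simp: G_class_def)

lemma finite_hypergraph_G: "finite_hypergraph G"
  unfolding finite_hypergraph_def
proof (intro conjI ballI subsetI)
  show "finite (verts G)" by (simp add: G_hyp_def copy_def)
next
  fix E v assume "E \<in> edges G" "v \<in> E"
  then obtain i e f where *: "i \<in> {1..p+1}" "e \<in> A_edge_class m x (L i)" "f \<in> \<phi> i e"
    "E = Inl ` e \<union> copy i f" using edge_cases by blast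
  have "e \<subseteq> AG_points m - {x}" "f \<subseteq> AG_points m'"
    using *(2) \<phi>_line[OF *(1-3)] A.line_subset[of e] J.line_subset[of f]
    by (auto simp: A_edge_class_iff)
  then show "v \<in> verts G" using \<open>v \<in> E\<close> * Inl_in_verts Inr_in_verts by (auto simp: copy_def)
qed

lemma uniform_G: "uniform (2 * p - 1) G"
  unfolding uniform_def
proof
  fix E assume "E \<in> edges G"
  then obtain i e f where *: "i \<in> {1..p+1}" "e \<in> A_edge_class m x (L i)" "f \<in> \<phi> i e"
    "E = Inl ` e \<union> copy i f" using edge_cases by blast
  have "card e = p" "card f = p - 1"
    using * \<phi>_line A.line_card J.line_card by (auto simp: A_edge_class_iff)
  then have "card E = p + (p - 1)"
    unfolding * by (subst card_Un_disjoint) (auto simp: card_image, auto simp: copy_def)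
  then show "finite E \<and> card E = 2 * p - 1" using p_ge_3 * by (simp add: copy_def)
qed

text \<open>If the parts in \<open>\<A>\<^sub>p\<close> are disjoint, they are distinct parallel
  lines with the same parallel through \<open>x\<close>, so \<open>i = i'\<close>. Injectivity of
  \<open>\<phi> i\<close> then gives different parallel classes in one copy, and \<open>f\<close>
  and \<open>f'\<close> cross.\<close>

lemma intersecting_G: "intersecting G"
  unfolding intersecting_def
proof (intro ballI)
  fix E E' assume "E \<in> edges G" "E' \<in> edges G"
  then obtain i e f i' e' f' where *: "i \<in> {1..p+1}" "e \<in> A_edge_class m x (L i)" "f \<in> \<phi> i e"
    "E = Inl ` e \<union> copy i f" and **: "i' \<in> {1..p+1}" "e' \<in> A_edge_class m x (L i')" "f' \<in> \<phi> i' e'"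
    "E' = Inl ` e' \<union> copy i' f'" using edge_cases by metis
  show "E \<inter> E' \<noteq> {}"
  proof (cases "e \<inter> e' = {}")
    case True
    note e = *(2)[unfolded A_edge_class_iff] and e' = **(2)[unfolded A_edge_class_iff]
    have Ln: "L i \<in> AG_lines m" "x \<in> L i" "L i' \<in> AG_lines m" "x \<in> L i'"
      using L_line * ** by auto
    have "parallel e e'" using True by (simp add: parallel_def)
    then have "parallel e (L i')" using e e' Ln A.parallel_trans[of e e' "L i'"] by simp
    then have "L i = L i'" using e Ln A.parallel_unique[of e "L i" "L i'" x] by simp
    then have i: "i = i'" using bij_L * ** by (auto simp: bij_betw_def inj_on_def)
    have "e \<noteq> e'" using True e A.line_nonempty by auto
    then have "\<phi> i e \<noteq> \<phi> i e'"
      using bij_\<phi>[OF *(1)] * ** i by (auto simp: bij_betw_def inj_on_def)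
    then have "\<not> parallel f f'"
      using J.pclass_eq_if_parallel \<phi>_pclass(1) * ** i by metis
    then obtain y where "y \<in> f" "y \<in> f'" by (auto simp: parallel_def)
    then have "Inr (i, y) \<in> E \<inter> E'" using * ** i by simp
    then show ?thesis by blast
  next
    case False
    then show ?thesis using * ** by blast
  qed
qed

section \<open>The enlarged classes as a partition met at most once by each edge\<close>

lemma V_exists:
  assumes "v \<in> verts G"
  shows "\<exists>j\<in>{1..2*p-1}. v \<in> V j"
proof (cases v)
  case (Inl u)
  then have u: "u \<in> AG_points m" "u \<noteq> x" using assms Inl_in_verts by auto
  then obtain l where "l \<in> AG_lines m" "x \<in> l" "u \<in> l" using A.line_through x by metis
  moreover from this obtain j where "j \<in> {1..p+1}" "L j = l"
    using L_surj by metis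
  ultimately show ?thesis using Inl u p_ge_3 Inl_in_V by (intro bexI[of _ j]) auto
next
  case (Inr w)
  then obtain i y where v: "v = Inr (i, y)" by (cases w) auto
  then have iy: "i \<in> {1..p+1}" "y \<in> AG_points m'" using assms Inr_in_verts by auto
  then obtain b where b: "b \<in> B" "y \<in> b" using B_partition by blast
  then have "\<sigma> i b \<in> {i} \<union> {p+2..2*p-1}" using bij_betw_apply[OF bij_\<sigma>[OF iy(1)]] by blast
  then have "\<sigma> i b \<in> {1..2*p-1}" using iy p_ge_3 by auto
  then show ?thesis using v iy b Inr_in_V by blast
qed

lemma V_unique:
  assumes "j \<in> {1..2*p-1}" "j' \<in> {1..2*p-1}" "v \<in> V j" "v \<in> V j'"
  shows "j = j'"
proof (cases v)
  case (Inl u)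
  then have u: "j \<in> {1..p+1}" "j' \<in> {1..p+1}" "u \<in> L j" "u \<in> L j'" "u \<noteq> x"
    using assms Inl_in_V by auto
  then have "L j = L j'" using L_line A.line_unique by metis
  then show ?thesis using bij_L u by (auto simp: bij_betw_def inj_on_def)
next
  case (Inr w)
  then obtain i y where v: "v = Inr (i, y)" by (cases w) auto
  then obtain b b' where b: "b \<in> B" "\<sigma> i b = j" "y \<in> b" "b' \<in> B" "\<sigma> i b' = j'" "y \<in> b'"
    using assms(3,4) unfolding v Inr_in_V by metis
  then have "b = b'" using disjointD[OF B_partition(2), of b b'] by blast
  then show ?thesis using b by simp
qed

lemma V_subset: "j \<in> {1..2*p-1} \<Longrightarrow> V j \<subseteq> verts G"
proof
  fix v assume j: "j \<in> {1..2*p-1}" and v: "v \<in> V j"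
  show "v \<in> verts G"
  proof (cases v)
    case (Inl u)
    then show ?thesis using j v L_line[of j] A.line_subset[of "L j"]
      by (auto simp: Inl_in_V Inl_in_verts)
  next
    case (Inr w)
    then show ?thesis using v B_partition(1) by (cases w) (auto simp: Inr_in_V Inr_in_verts)
  qed
qed

lemma V_nonempty:
  assumes "j \<in> {1..2*p-1}"
  shows "V j \<noteq> {}"
proof (cases "j \<le> p + 1")
  case True
  then have j: "j \<in> {1..p+1}" using assms by auto
  have "\<not> L j \<subseteq> {x}"
  proof
    assume "L j \<subseteq> {x}"
    then have "card (L j) \<le> 1" using card_mono[of "{x}" "L j"] by simp
    then show False using A.line_card L_line[OF j] p_ge_3 by simp
  qed
  then obtain u where "u \<in> L j" "u \<noteq> x" by blast
  then have "Inl u \<in> V j" using True Inl_in_V by blast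
  then show ?thesis by blast
next
  case False
  \<comment> \<open>Every new class receives a vertex class from each copy; the first copy is used
    as a witness.\<close>
  then have "j \<in> {1} \<union> {p+2..2*p-1}" using assms by auto
  moreover have "\<sigma> 1 ` B = {1} \<union> {p+2..2*p-1}" using bij_\<sigma>[of 1] by (simp add: bij_betw_def)
  ultimately obtain b where b: "b \<in> B" "\<sigma> 1 b = j" by (metis imageE)
  then obtain y where "y \<in> b" using B_line J.line_nonempty by blast
  then have "Inr (1, y) \<in> V j" using b Inr_in_V by auto
  then show ?thesis by blast
qed

text \<open>Three kinds of collision are excluded. \<open>LL\<close>: \<open>e\<close> avoids
  \<open>x\<close>, so it differs from \<open>L j\<close> and meets it at most once.
  \<open>RR\<close>: only one line of \<open>B\<close> goes to index \<open>j\<close>, and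
  \<open>f\<close> crosses it once, its class not being \<open>B\<close>. \<open>LR\<close>: the old
  classes receive vertices of the \<open>i\<close>-th copy only at index \<open>i\<close>, and
  \<open>e\<close> is disjoint from \<open>L i\<close>.\<close>

lemma edge_meets_V_once:
  assumes "E \<in> edges G" "j \<in> {1..2*p-1}" "u \<in> E \<inter> V j" "v \<in> E \<inter> V j"
  shows "u = v"
proof -
  obtain i e f where *: "i \<in> {1..p+1}" "e \<in> A_edge_class m x (L i)" "f \<in> \<phi> i e"
    "E = Inl ` e \<union> copy i f" using edge_cases assms(1) by blast
  note e = *(2)[unfolded A_edge_class_iff]
  have LL: "c = c'" if "c \<in> e" "c \<in> L j" "c' \<in> e" "c' \<in> L j" "j \<le> p + 1" for c c'
    using that e L_line[of j] assms(2) A.line_unique[of c e c' "L j"] by auto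
  have RR: "y = y'" if y: "y \<in> f" "y \<in> b" "b \<in> B" "\<sigma> i b = j" "y' \<in> f" "y' \<in> b'" "b' \<in> B" "\<sigma> i b' = j"
    for y y' b b'
  proof (rule ccontr)
    assume "y \<noteq> y'"
    moreover have "b = b'" using bij_\<sigma>[OF *(1)] y by (auto simp: bij_betw_def inj_on_def)
    ultimately have "f = b"
      using y \<phi>_line[OF *(1-3)] B_line J.line_unique[of y f y' b] by auto
    then have "\<phi> i e = B"
      using J.pclass_eq_if_parallel[OF \<phi>_pclass(1)[OF *(1,2)] B_pclass *(3) y(3)]
      by (simp add: parallel_def)
    then show False using \<phi>_pclass(2)[OF *(1,2)] by simp
  qed
  have LR: False if y: "c \<in> e" "c \<in> L j" "j \<le> p + 1" "b \<in> B" "\<sigma> i b = j" for c b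
  proof -
    have "j \<in> {i} \<union> {p+2..2*p-1}" using bij_betw_apply[OF bij_\<sigma>[OF *(1)] y(4)] y by simp
    then have "j = i" using y(3) by auto
    then have "e = L i" using e y by (auto simp: parallel_def)
    then show False using e L_line[OF *(1)] by auto
  qed
  have u: "u \<in> E" "u \<in> V j" and v: "v \<in> E" "v \<in> V j" using assms by auto
  show ?thesis
  proof (cases u)
    case ul: (Inl c)
    show ?thesis
    proof (cases v)
      case (Inl c')
      then show ?thesis using LL[of c c'] u v ul * by (auto simp: Inl_in_V)
    next
      case (Inr w)
      then show ?thesis using LR[of c] u v ul * by (cases w) (auto simp: Inl_in_V Inr_in_V)
    qed
  next
    case ur: (Inr w)
    then obtain y where y: "u = Inr (i, y)" "y \<in> f" using u * by (auto simp: copy_def)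
    show ?thesis
    proof (cases v)
      case (Inl c)
      then show ?thesis using LR[of c] u v y * by (auto simp: Inl_in_V Inr_in_V)
    next
      case (Inr w')
      then obtain y' where y': "v = Inr (i, y')" "y' \<in> f" using v * by (auto simp: copy_def)
      obtain b b' where "b \<in> B" "\<sigma> i b = j" "y \<in> b" "b' \<in> B" "\<sigma> i b' = j" "y' \<in> b'"
        using u v y y' Inr_in_V by blast
      then show ?thesis using RR y y' by blast
    qed
  qed
qed

lemma partite_with_G: "partite_with (2 * p - 1) G (V ` {1..2*p-1})"
  unfolding partite_with_def
proof (intro conjI)
  \<comment> \<open>Disjointness alone would allow several empty classes to coincide; nonemptiness
    makes the index set count them.\<close>
  have inj: "inj_on V {1..2*p-1}"
    unfolding inj_on_def using V_nonempty V_unique by blast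
  show "card (V ` {1..2*p-1}) = 2 * p - 1" using card_image[OF inj] by simp
  show "partition_on (verts G) (V ` {1..2*p-1})"
    unfolding partition_on_def
  proof (intro conjI)
    show "\<Union> (V ` {1..2*p-1}) = verts G" using V_exists V_subset by blast
    show "disjoint (V ` {1..2*p-1})" unfolding disjoint_def using V_unique by blast
    show "{} \<notin> V ` {1..2*p-1}" using V_nonempty by blast
  qed
  show "\<forall>E\<in>edges G. \<forall>c\<in>V ` {1..2*p-1}. \<forall>u\<in>E \<inter> c. \<forall>v\<in>E \<inter> c. u = v"
    using edge_meets_V_once by blast
qed simp

text \<open>If all edges of \<open>\<A>\<^sub>p\<close> are covered inside \<open>\<A>\<^sub>p\<close>, the bound on affine blocking sets applies.
  An uncovered edge of \<open>C\<^sub>i\<close> costs \<open>p - 1\<close> vertices of the \<open>i\<close>-th copy of \<open>\<J>\<close>, one for each member of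
  its parallel class; a completely covered \<open>C\<^sub>j\<close> costs \<open>p - 1\<close> vertices of \<open>\<A>\<^sub>p\<close>. Since there are at
  least two classes \<open>C\<^sub>i\<close>, one of these costs arises twice or both arise once.\<close>

lemma vertex_cover_card:
  assumes "vertex_cover G T"
  shows "2 * p - 2 \<le> card T"
proof -
  have T: "T \<subseteq> verts G" "\<And>E. E \<in> edges G \<Longrightarrow> T \<inter> E \<noteq> {}"
    using assms by (auto simp: vertex_cover_def)
  have fin: "finite T" using T(1) finite_hypergraph_G finite_subset
    by (auto simp: finite_hypergraph_def)
  define A where "A = {v. Inl v \<in> T}"
  define C where "C i = {y. Inr (i, y) \<in> T}" for i :: nat
  define T\<^sub>A where "T\<^sub>A = T \<inter> range Inl"
  define T\<^sub>C where "T\<^sub>C i = T \<inter> copy i UNIV" for i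
  have "T\<^sub>A = Inl ` A" by (auto simp: T\<^sub>A_def A_def)
  then have A: "card T\<^sub>A = card A" by (simp add: card_image)
  have "T\<^sub>C i = copy i (C i)" for i by (auto simp: T\<^sub>C_def C_def copy_def)
  then have C: "card (T\<^sub>C i) = card (C i)" for i by simp
  define unc where "unc i \<longleftrightarrow> (\<exists>e\<in>A_edge_class m x (L i). A \<inter> e = {})" for i
  have unc: "p - 1 \<le> card (C i)" if i: "i \<in> {1..p+1}" and "unc i" for i
  proof -
    obtain e where e: "e \<in> A_edge_class m x (L i)" "A \<inter> e = {}" using \<open>unc i\<close> unc_def by blast
    obtain l where l: "l \<in> AG_lines m'" "\<phi> i e = J.pclass l" using \<phi>_pclass(1)[OF i e(1)] by blast
    \<comment> \<open>All edges over the missed \<open>e\<close> must be met in the copy, and their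
      parts there are pairwise disjoint.\<close>
    have "C i \<inter> f \<noteq> {}" if f: "f \<in> \<phi> i e" for f
    proof -
      have "Inl ` e \<union> copy i f \<in> edges G" using i e f by (auto simp: G_hyp_def)
      then have "T \<inter> (Inl ` e \<union> copy i f) \<noteq> {}" by (rule T(2))
      then show ?thesis using e(2) by (auto simp: A_def C_def copy_def)
    qed
    then have "card (\<phi> i e) \<le> card (C i)"
      using l J.pclass_disjoint by (intro card_le_card_transversal) auto
    then show ?thesis using l J.card_pclass by simp
  qed
  have cov: "p - 1 \<le> card A" if i: "i \<in> {1..p+1}" and "\<not> unc i" for i
    using card_le_card_transversal[OF disjoint_A_edge_class[OF i], of A] \<open>\<not> unc i\<close>
      card_A_edge_class[OF i] by (auto simp: unc_def)
  consider "\<forall>i\<in>{1..p+1}. \<not> unc i"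
    | i j where "i \<in> {1..p+1}" "j \<in> {1..p+1}" "i \<noteq> j" "unc i" "unc j"
    | i where "i \<in> {1..p+1}" "unc i" "\<forall>j\<in>{1..p+1}. j \<noteq> i \<longrightarrow> \<not> unc j"
    by blast
  then show ?thesis
  proof cases
    case 1
    have "2 * (CARD('k) - 1) \<le> card A"
    proof (rule card_cover_lines_missing_point[OF m x])
      show "A \<subseteq> AG_points m" using T(1) Inl_in_verts by (auto simp: A_def)
      show "A \<inter> l \<noteq> {}" if "l \<in> AG_lines m" "x \<notin> l" for l
        using edge_class_exists[OF that] 1 by (auto simp: unc_def)
    qed
    also have "\<dots> \<le> card T" unfolding A[symmetric] using fin by (intro card_mono) (auto simp: T\<^sub>A_def)
    finally show ?thesis using CARD_k by simp
  next
    case (2 i j)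
    have "card (T\<^sub>C i) + card (T\<^sub>C j) \<le> card T"
      using 2(3) by (intro card_add_le[OF fin]) (auto simp: T\<^sub>C_def copy_def)
    then show ?thesis using unc[OF 2(1,4)] unc[OF 2(2,5)] C by simp
  next
    case (3 i)
    obtain j where j: "j \<in> {1..p+1}" "j \<noteq> i"
      using that[of "if i = 1 then 2 else 1"] p_ge_3 by auto
    have "card T\<^sub>A + card (T\<^sub>C i) \<le> card T"
      by (intro card_add_le[OF fin]) (auto simp: T\<^sub>A_def T\<^sub>C_def copy_def)
    moreover have "p - 1 \<le> card A" "p - 1 \<le> card (C i)" using cov unc 3 j by auto
    ultimately show ?thesis using A C by simp
  qed
qed

text \<open>The \<open>LEAST\<close> must be shown to be attained; since edges are nonempty, the
  full vertex set is a finite cover.\<close>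

lemma cover_number_G: "2 * p - 2 \<le> cover_number G"
proof -
  have "vertex_cover G (verts G)"
    unfolding vertex_cover_def
  proof (intro conjI ballI)
    fix E assume E: "E \<in> edges G"
    then have "E \<subseteq> verts G" using finite_hypergraph_G by (simp add: finite_hypergraph_def)
    moreover have "E \<noteq> {}" using uniform_G E p_ge_3 by (auto simp: uniform_def)
    ultimately show "verts G \<inter> E \<noteq> {}" by blast
  qed simp
  then have "\<exists>n T. vertex_cover G T \<and> finite T \<and> card T = n"
    using finite_hypergraph_G by (auto simp: finite_hypergraph_def)
  from LeastI_ex[OF this] obtain T where "vertex_cover G T" "card T = cover_number G"
    unfolding cover_number_def by blast
  then show ?thesis using vertex_cover_card by metis
qed

end

theorem theorem7:
  fixes p r :: nat
    and m :: "('k::{field,finite} ^ 3) set set" and x :: "('k ^ 3) set"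
    and L :: "nat \<Rightarrow> ('k ^ 3) set set"
    and m' :: "('l::{field,finite} ^ 3) set set" and B :: "('l ^ 3) set set set"
    and \<sigma> :: "nat \<Rightarrow> ('l ^ 3) set set \<Rightarrow> nat"
    and \<phi> :: "nat \<Rightarrow> ('k ^ 3) set set \<Rightarrow> ('l ^ 3) set set set"
  assumes "primepow p" and "primepow (p - 1)" and "r = 2 * p - 1"
    and "CARD('k) = p" and "CARD('l) = p - 1"
    and "m \<in> PG_lines" and "x \<in> AG_points m"
    and "bij_betw L {1..p+1} {l \<in> AG_lines m. x \<in> l}"
    and "m' \<in> PG_lines" and "B \<in> AG_parallel_classes m'"
    and "\<And>i. i \<in> {1..p+1} \<Longrightarrow> bij_betw (\<sigma> i) B ({i} \<union> {p+2..2*p-1})"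
    and "\<And>i. i \<in> {1..p+1} \<Longrightarrow>
           bij_betw (\<phi> i) (A_edge_class m x (L i)) (J_edge_classes m' B)"
  shows "finite_hypergraph (G_hyp p m x L m' B \<phi>)
      \<and> partite_with r (G_hyp p m x L m' B \<phi>) (G_class p x L B \<sigma> ` {1..2*p-1})
      \<and> uniform r (G_hyp p m x L m' B \<phi>)
      \<and> intersecting (G_hyp p m x L m' B \<phi>)
      \<and> cover_number (G_hyp p m x L m' B \<phi>) \<ge> r - 1"
proof -
  interpret G_construction p m x L m' B \<sigma> \<phi>
    by (rule G_construction.intro; fact assms)
  show ?thesis
    using finite_hypergraph_G partite_with_G uniform_G intersecting_G cover_number_G \<open>r = 2 * p - 1\<close>
    by simp
qed

end
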